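(* Let $\mathcal{L}$ be a $4$-dimensional solvable Leibniz algebra over $\mathbb{C}$ whose nilradical is isomorphic to the $3$-dimensional algebra $\lambda_3:\ [e_1,e_2]=e_3,\ [e_2,e_1]=-e_3$. Then $\mathcal{L}$ is isomorphic to one of the following pairwise non-isomorphic algebras, each with basis $\{x,e_1,e_2,e_3\}$: $$\mathcal{L}_1(\gamma)\ (\gamma\in\mathbb{C}):\ [e_1,e_2]=e_3,\ [e_2,e_1]=-e_3,\ [e_1,x]=e_1,\ [e_2,x]=\gamma e_2,\ [e_3,x]=(1+\gamma)e_3,$$ $$\qquad [x,e_1]=-e_1,\ [x,e_2]=-\gamma e_2,\ [x,e_3]=-(1+\gamma)e_3;$$ $$\mathcal{L}_2:\ [e_1,e_2]=e_3,\ [e_2,e_1]=-e_3,\ [e_1,x]=e_1,\ [e_2,x]=-e_2,\ [x,e_1]=-e_1,\ [x,e_2]=e_2,\ [x,x]=e_3;$$ $$\mathcal{L}_3:\ [e_1,e_2]=e_3,\ [e_2,e_1]=-e_3,\ [e_1,x]=e_1+e_2,\ [e_2,x]=e_2,\ [e_3,x]=2e_3,$$ $$\qquad [x,e_1]=-e_1-e_2,\ [x,e_2]=-e_2,\ [x,e_3]=-2e_3.$$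
   Context: A (right) Leibniz algebra over $\mathbb{C}$ is a $\mathbb{C}$-vector space $\mathcal{L}$ with a bilinear bracket $[-,-]:\mathcal{L}\times\mathcal{L}\to\mathcal{L}$ satisfying $[x,[y,z]]=[[x,y],z]-[[x,z],y]$ for all $x,y,z\in\mathcal{L}$. All algebras are finite-dimensional over $\mathbb{C}$. Define $\mathcal{L}^1=\mathcal{L}$, $\mathcal{L}^{k+1}=[\mathcal{L}^k,\mathcal{L}]$ and $\mathcal{L}^{[1]}=\mathcal{L}$, $\mathcal{L}^{[s+1]}=[\mathcal{L}^{[s]},\mathcal{L}^{[s]}]$; $\mathcal{L}$ is nilpotent (resp. solvable) if $\mathcal{L}^n=0$ for some $n$ (resp. $\mathcal{L}^{[m]}=0$ for some $m$). The nilradical of $\mathcal{L}$ is its maximal nilpotent (two-sided) ideal. In multiplication tables, products of basis elements that are not listed are zero.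
   Formalization: Since L_1(γ) ≅ L_1(1/γ) for γ ≠ 0 (swap e_1 and e_2, negate e_3, rescale x), "pairwise non-isomorphic" is false as stated within the family L_1; there it is proved for γ ≠ δ with γδ ≠ 1, and L_1(γ), L_2, L_3 are mutually non-isomorphic for every γ. *)

theory Defs
  imports "HOL-Analysis.Analysis"
begin

text \<open>Right Leibniz algebras over the complex numbers. The underlying vector space is the whole
  type \<open>'a\<close> with scalar multiplication \<open>scale\<close>; subalgebras and ideals are sets.\<close>

locale leibniz_algebra = vector_space scale
  for scale :: "complex \<Rightarrow> 'a::ab_group_add \<Rightarrow> 'a" +
  fixes br :: "'a \<Rightarrow> 'a \<Rightarrow> 'a"
  assumes br_add_left: "br (x + y) z = br x z + br y z"
    and br_add_right: "br x (y + z) = br x y + br x z"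
    and br_scale_left: "br (scale c x) y = scale c (br x y)"
    and br_scale_right: "br x (scale c y) = scale c (br x y)"
    and leibniz: "br x (br y z) = br (br x y) z - br (br x z) y"
begin

definition bracket_space :: "'a set \<Rightarrow> 'a set \<Rightarrow> 'a set" where
  "bracket_space A B = span {br a b | a b. a \<in> A \<and> b \<in> B}"

text \<open>Both series are indexed from 0, so \<open>lower_series A k\<close> is \<open>A\<^sup>k\<^sup>+\<^sup>1\<close> and
  \<open>derived_series A k\<close> is \<open>A\<^sup>[\<^sup>k\<^sup>+\<^sup>1\<^sup>]\<close>. They only involve
  brackets of elements of \<open>A\<close>, i.e. \<open>A\<close> is considered as an algebra in its own right.\<close>

primrec lower_series :: "'a set \<Rightarrow> nat \<Rightarrow> 'a set" where
  "lower_series A 0 = A"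
| "lower_series A (Suc k) = bracket_space (lower_series A k) A"

primrec derived_series :: "'a set \<Rightarrow> nat \<Rightarrow> 'a set" where
  "derived_series A 0 = A"
| "derived_series A (Suc k) = bracket_space (derived_series A k) (derived_series A k)"

definition nilpotent :: "'a set \<Rightarrow> bool" where
  "nilpotent A \<longleftrightarrow> (\<exists>n. lower_series A n = {0})"

definition solvable :: "'a set \<Rightarrow> bool" where
  "solvable A \<longleftrightarrow> (\<exists>m. derived_series A m = {0})"

definition two_sided_ideal :: "'a set \<Rightarrow> bool" where
  "two_sided_ideal I \<longleftrightarrow> subspace I \<and> (\<forall>a\<in>I. \<forall>y. br a y \<in> I \<and> br y a \<in> I)"

text \<open>Maximality is with respect to inclusion. In finite dimension sums of nilpotent ideals are
  nilpotent, so there is exactly one such ideal.\<close>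

definition is_nilradical :: "'a set \<Rightarrow> bool" where
  "is_nilradical N \<longleftrightarrow> two_sided_ideal N \<and> nilpotent N \<and>
     (\<forall>M. two_sided_ideal M \<and> nilpotent M \<and> N \<subseteq> M \<longrightarrow> M = N)"

end

text \<open>Isomorphism of algebras with carriers \<open>A\<close> and \<open>A'\<close>, which are meant to be subspaces
  closed under the brackets \<open>br\<close> and \<open>br'\<close>.\<close>

definition algebra_isomorphic ::
  "(complex \<Rightarrow> 'a::ab_group_add \<Rightarrow> 'a) \<Rightarrow> 'a set \<Rightarrow> ('a \<Rightarrow> 'a \<Rightarrow> 'a) \<Rightarrow>
   (complex \<Rightarrow> 'b::ab_group_add \<Rightarrow> 'b) \<Rightarrow> 'b set \<Rightarrow> ('b \<Rightarrow> 'b \<Rightarrow> 'b) \<Rightarrow> bool" where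
  "algebra_isomorphic s A br s' A' br' \<longleftrightarrow>
     (\<exists>f. bij_betw f A A' \<and>
          (\<forall>x\<in>A. \<forall>y\<in>A. f (x + y) = f x + f y) \<and>
          (\<forall>c. \<forall>x\<in>A. f (s c x) = s' c (f x)) \<and>
          (\<forall>x\<in>A. \<forall>y\<in>A. f (br x y) = br' (f x) (f y)))"

text \<open>The bilinear bracket given by a multiplication table: an entry \<open>(i, j, w)\<close> says that the
  product of the \<open>i\<close>-th and the \<open>j\<close>-th standard basis vector is \<open>w\<close>. Pairs \<open>(i, j)\<close> that do not
  occur have product zero; a pair may be listed only once.\<close>

definition table_bracket ::
  "('n \<times> 'n \<times> (complex ^ 'n)) list \<Rightarrow> complex ^ 'n \<Rightarrow> complex ^ 'n \<Rightarrow> complex ^ 'n" where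
  "table_bracket T u v = (\<Sum>(i, j, w)\<leftarrow>T. (u $ i * v $ j) *s w)"

abbreviation e :: "'n \<Rightarrow> complex ^ 'n" where
  "e i \<equiv> axis i 1"

definition lambda3 :: "complex ^ 3 \<Rightarrow> complex ^ 3 \<Rightarrow> complex ^ 3" where
  "lambda3 = table_bracket [(1, 2, e 3), (2, 1, - e 3)]"

text \<open>In the four-dimensional tables, \<open>x\<close> is the basis vector with index 4.\<close>

definition L1 :: "complex \<Rightarrow> complex ^ 4 \<Rightarrow> complex ^ 4 \<Rightarrow> complex ^ 4" where
  "L1 \<gamma> = table_bracket
     [(1, 2, e 3), (2, 1, - e 3),
      (1, 4, e 1), (2, 4, \<gamma> *s e 2), (3, 4, (1 + \<gamma>) *s e 3),
      (4, 1, - e 1), (4, 2, - \<gamma> *s e 2), (4, 3, - (1 + \<gamma>) *s e 3)]"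

definition L2 :: "complex ^ 4 \<Rightarrow> complex ^ 4 \<Rightarrow> complex ^ 4" where
  "L2 = table_bracket
     [(1, 2, e 3), (2, 1, - e 3),
      (1, 4, e 1), (2, 4, - e 2),
      (4, 1, - e 1), (4, 2, e 2), (4, 4, e 3)]"

definition L3 :: "complex ^ 4 \<Rightarrow> complex ^ 4 \<Rightarrow> complex ^ 4" where
  "L3 = table_bracket
     [(1, 2, e 3), (2, 1, - e 3),
      (1, 4, e 1 + e 2), (2, 4, e 2), (3, 4, 2 *s e 3),
      (4, 1, - e 1 - e 2), (4, 2, - e 2), (4, 3, - 2 *s e 3)]"

abbreviation isomorphic4 ::
  "(complex ^ 4 \<Rightarrow> complex ^ 4 \<Rightarrow> complex ^ 4) \<Rightarrow> (complex ^ 4 \<Rightarrow> complex ^ 4 \<Rightarrow> complex ^ 4) \<Rightarrow> bool" where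
  "isomorphic4 b b' \<equiv> algebra_isomorphic (*s) UNIV b (*s) UNIV b'"

lemmas table_simps = table_bracket_def vec_eq_iff forall_4 forall_3 axis_def

lemma leibniz_lambda3: "leibniz_algebra (*s) lambda3"
  by unfold_locales (simp_all add: lambda3_def table_simps algebra_simps)

lemma leibniz_L1: "leibniz_algebra (*s) (L1 \<gamma>)"
  by unfold_locales (simp_all add: L1_def table_simps algebra_simps)

lemma leibniz_L2: "leibniz_algebra (*s) L2"
  by unfold_locales (simp_all add: L2_def table_simps algebra_simps)

lemma leibniz_L3: "leibniz_algebra (*s) L3"
  by unfold_locales (simp_all add: L3_def table_simps algebra_simps)

text \<open>Within the family \<open>L1\<close> the parameters \<open>\<gamma>\<close> and \<open>1 / \<gamma>\<close> give isomorphic algebras: interchange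
  \<open>e\<^sub>1\<close> and \<open>e\<^sub>2\<close>, negate \<open>e\<^sub>3\<close> and rescale \<open>x\<close>.\<close>

lemma L1_isomorphic_inverse:
  assumes "\<gamma> * \<delta> = 1"
  shows "isomorphic4 (L1 \<gamma>) (L1 \<delta>)"
proof -
  define f :: "complex \<Rightarrow> complex ^ 4 \<Rightarrow> complex ^ 4"
    where "f c v = (\<chi> i. if i = 1 then v $ 2 else if i = 2 then v $ 1
                          else if i = 3 then - v $ 3 else c * v $ 4)" for c v
  have f_simps: "f c v $ 1 = v $ 2" "f c v $ 2 = v $ 1" "f c v $ 3 = - v $ 3" "f c v $ 4 = c * v $ 4"
    for c v by (simp_all add: f_def)
  have c: "\<gamma> * (\<delta> * z) = z" "\<delta> * (\<gamma> * z) = z" for z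
    using assms by (simp_all add: mult.assoc [symmetric] mult.commute [of \<delta> \<gamma>])
  have "bij (f \<gamma>)"
    by (rule bij_betw_byWitness [where f' = "f \<delta>"]) (auto simp: vec_eq_iff forall_4 f_simps c)
  moreover have "f \<gamma> (L1 \<gamma> u v) = L1 \<delta> (f \<gamma> u) (f \<gamma> v)" for u v
    by (simp add: L1_def table_simps f_simps algebra_simps c)
  ultimately show ?thesis
    unfolding algebra_isomorphic_def
    by (intro exI [of _ "f \<gamma>"]) (simp add: vec_eq_iff forall_4 f_simps algebra_simps)
qed

end

theory Submission
  imports Defs
begin

text \<open>
  Let \<open>N\<close> be the nilradical, with basis \<open>a, b, c\<close> where \<open>c = [a,b] = - [b,a]\<close> spans the centre of
  \<open>N\<close>, and let \<open>x \<notin> N\<close>. Everything is governed by the derivation \<open>D = [-,x]\<close> of \<open>N\<close>, more precisely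
  by the \<open>2 \<times> 2\<close> matrix that it induces on \<open>N / \<complex> c\<close>; on \<open>c\<close> it is multiplication by the trace.

  The Leibniz identity makes every symmetrized bracket \<open>[u,v] + [v,u]\<close> a right annihilator. Hence
  \<open>[x,x]\<close> and \<open>[x,n] + [n,x]\<close> for \<open>n \<in> N\<close> are multiples of \<open>c\<close>. Bring the matrix of \<open>D\<close> to triangular
  form. Since inner derivations of \<open>N\<close> take \<open>a\<close> and \<open>b\<close> to arbitrary multiples of \<open>c\<close>, replacing \<open>x\<close> by
  \<open>x + n\<close> with a suitable \<open>n \<in> N\<close> removes the \<open>c\<close>-components of \<open>D a\<close> and \<open>D b\<close>
  (\<open>triangular_generator\<close>). The matrix is not nilpotent, since otherwise the whole algebra would be
  nilpotent (\<open>not_strictly_triangular\<close>), against the maximality of \<open>N\<close>. Therefore the remaining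
  Leibniz identities force \<open>[x,n] = - [n,x]\<close>, so that besides \<open>D\<close> the only free datum is the scalar \<open>d\<close>
  in \<open>[x,x] = d c\<close>, which vanishes unless the trace does (\<open>multiplication_table\<close>). If the matrix is
  diagonalizable, rescaling \<open>x\<close> makes its eigenvalues \<open>1, \<gamma>\<close>; this gives \<open>L1 \<gamma>\<close> when \<open>d = 0\<close>, while
  \<open>d \<noteq> 0\<close> needs \<open>\<gamma> = - 1\<close> and gives \<open>L2\<close>. A Jordan block gives \<open>L3\<close>.

  To separate the tables, \<open>L2\<close> is the only one in which some square \<open>[u,u]\<close> is non-zero. For the
  others, an isomorphism conjugates right multiplications, so it preserves the traces of
  \<open>R\<^sub>u = [-,u]\<close> and of its square, which in \<open>L1 \<gamma>\<close> are \<open>2 (1 + \<gamma>) s\<close> and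
  \<open>2 (1 + \<gamma> + \<gamma>\<^sup>2) s\<^sup>2\<close> with \<open>s\<close> the \<open>x\<close>-coordinate of \<open>u\<close>. Eliminating \<open>s\<close> leaves
  \<open>(\<gamma> - \<delta>) (\<gamma> \<delta> - 1) = 0\<close>. The traces of \<open>L3\<close> are those of \<open>L1 1\<close>, but in the former the
  right multiplication by \<open>x\<close> is not diagonalizable.
\<close>

section \<open>Algebras with a Heisenberg ideal of codimension one\<close>

lemma complex_quadratic_root:
  fixes t d :: complex
  obtains l where "l * l = t * l - d"
proof -
  define r where "r = csqrt (t * t - 4 * d)"
  have "r * r = t * t - 4 * d"
    unfolding r_def using power2_csqrt[of "t * t - 4 * d"] by (simp add: power2_eq_square)
  moreover define l where "l = (t + r) / 2"
  then have "l * 2 = t + r" by simp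
  ultimately have "4 * (l * l) = 4 * (t * l - d)" by algebra
  then have "l * l = t * l - d" unfolding mult_cancel_left by simp
  then show thesis by (rule that)
qed

context leibniz_algebra
begin

sublocale br_left: module_hom scale scale "\<lambda>u. br u v" for v
  by unfold_locales (simp_all add: br_add_left br_scale_left)

sublocale br_right: module_hom scale scale "br u" for u
  by unfold_locales (simp_all add: br_add_right br_scale_right)

lemmas br_simps = br_add_left br_add_right br_scale_left br_scale_right
  br_left.zero br_right.zero br_left.neg br_right.neg br_left.diff br_right.diff

text \<open>Both brackets \<open>[y,[u,v]]\<close> and \<open>[y,[v,u]]\<close> expand to the same two terms, with opposite signs.\<close>

lemma br_symmetrized_right: "br y (br u v + br v u) = 0"
  by (simp add: br_add_right leibniz)

lemma span_pairE:
  assumes "u \<in> span {b, c}"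
  obtains q r where "u = scale q b + scale r c"
proof -
  from assms obtain q where "u - scale q b \<in> span {c}"
    unfolding span_breakdown_eq by blast
  then obtain r where "u - scale q b = scale r c"
    by (auto simp: span_singleton)
  then have "u = scale q b + scale r c" by (simp add: diff_eq_eq add.commute)
  then show thesis by (rule that)
qed

lemma bracket_space_least:
  assumes "\<And>u v. u \<in> A \<Longrightarrow> v \<in> B \<Longrightarrow> br u v \<in> S" "subspace S"
  shows "bracket_space A B \<subseteq> S"
  unfolding bracket_space_def by (rule span_minimal) (use assms in auto)

end

text \<open>The maximality of \<open>N\<close> among nilpotent ideals enters in the form that the algebra itself is not
  nilpotent.\<close>

locale heisenberg_extension = leibniz_algebra scale br
  for scale :: "complex \<Rightarrow> 'a::ab_group_add \<Rightarrow> 'a" and br :: "'a \<Rightarrow> 'a \<Rightarrow> 'a" +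
  fixes N :: "'a set"
  assumes ideal: "two_sided_ideal N"
    and codim_one: "x \<notin> N \<Longrightarrow> \<exists>t. v - scale t x \<in> N"
    and not_nilpotent: "\<not> nilpotent UNIV"
begin

text \<open>Linear independence is encoded by \<open>c \<noteq> 0\<close>: bracketing a linear relation between \<open>a\<close>, \<open>b\<close> and
  \<open>c\<close> with \<open>a\<close> and \<open>b\<close> leaves multiples of \<open>c\<close>.\<close>

definition heisenberg_basis :: "'a \<Rightarrow> 'a \<Rightarrow> 'a \<Rightarrow> bool" where
  "heisenberg_basis a b c \<longleftrightarrow>
     a \<in> N \<and> b \<in> N \<and> (\<forall>n\<in>N. \<exists>p q r. n = scale p a + scale q b + scale r c) \<and> c \<noteq> 0 \<and>
     br a b = c \<and> br b a = - c \<and> br a a = 0 \<and> br b b = 0 \<and>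
     br a c = 0 \<and> br c a = 0 \<and> br b c = 0 \<and> br c b = 0 \<and> br c c = 0"

lemma subspace_N: "subspace N"
  using ideal by (simp add: two_sided_ideal_def)

lemma br_N: "n \<in> N \<Longrightarrow> br n y \<in> N" "n \<in> N \<Longrightarrow> br y n \<in> N"
  using ideal by (auto simp: two_sided_ideal_def)

lemmas N_closed = subspace_0[OF subspace_N] subspace_add[OF subspace_N] subspace_diff[OF subspace_N]
  subspace_neg[OF subspace_N] subspace_scale[OF subspace_N]

lemma heisenberg_basisD:
  assumes "heisenberg_basis a b c"
  shows "a \<in> N" "b \<in> N" "c \<in> N" "c \<noteq> 0"
    "br a b = c" "br b a = - c" "br a a = 0" "br b b = 0"
    "br a c = 0" "br c a = 0" "br b c = 0" "br c b = 0" "br c c = 0"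
  using assms br_N(1)[of a b] unfolding heisenberg_basis_def by auto

lemma heisenberg_coordinates:
  assumes "heisenberg_basis a b c" "n \<in> N"
  obtains p q r where "n = scale p a + scale q b + scale r c"
  using assms unfolding heisenberg_basis_def by blast

lemma scale_notin_N:
  assumes "x \<notin> N" "scale t x \<in> N" shows "t = 0"
proof (rule ccontr)
  assume "t \<noteq> 0"
  with N_closed(5)[OF assms(2), of "inverse t"] assms(1) show False by simp
qed

text \<open>Modulo \<open>N\<close> the square of \<open>x\<close> is \<open>t x\<close>, and \<open>[x,[x,x]] = 0\<close> becomes \<open>t\<^sup>2 x = 0\<close>.\<close>

lemma square_in_N: "br x x \<in> N"
proof (cases "x \<in> N")
  case False
  from codim_one[OF this, of "br x x"] obtain t where t: "br x x - scale t x \<in> N" ..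
  define n where "n = br x x - scale t x"
  then have xx: "br x x = scale t x + n" and n: "n \<in> N" using t by auto
  have "0 = br x (br x x)" by (simp add: leibniz)
  also have "\<dots> = scale (t * t) x + (scale t n + br x n)"
    by (simp add: xx br_simps scale_right_distrib add.assoc)
  finally have "scale (t * t) x = - (scale t n + br x n)"
    by (metis eq_neg_iff_add_eq_0)
  also have "\<dots> \<in> N" by (intro N_closed br_N n)
  finally have "t * t = 0" by (rule scale_notin_N[OF False])
  then have "t = 0" by simp
  with xx n show ?thesis by simp
qed (rule br_N)

text \<open>Elements of \<open>N\<close> that annihilate from the right lie on the line of \<open>c\<close>. This is how symmetrized
  brackets are turned into scalars.\<close>

lemma heisenberg_centre:
  assumes f: "heisenberg_basis a b c" and n: "n \<in> N" "br a n = 0" "br b n = 0"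
  obtains k where "n = scale k c"
proof -
  from f n(1) obtain p q r where pqr: "n = scale p a + scale q b + scale r c"
    by (rule heisenberg_coordinates)
  have "scale q c = 0" "scale p c = 0"
    using n(2,3) heisenberg_basisD[OF f] by (simp_all add: pqr br_simps)
  then have "n = scale r c" using heisenberg_basisD(4)[OF f] by (simp add: pqr)
  then show thesis by (rule that)
qed

lemma bracket_skew_mod_centre:
  assumes f: "heisenberg_basis a b c" and n: "n \<in> N"
  obtains k where "br x n = - br n x + scale k c"
proof -
  have "br x n + br n x \<in> N" by (intro N_closed br_N n)
  from heisenberg_centre[OF f this] obtain k where "br x n + br n x = scale k c"
    using br_symmetrized_right by metis
  then have "br x n = - br n x + scale k c" by (metis add.commute minus_add_cancel)
  then show thesis by (rule that)
qed

lemma square_central: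
  assumes f: "heisenberg_basis a b c"
  obtains k where "br x x = scale k c"
  by (rule heisenberg_centre[OF f square_in_N[of x]]) (auto simp: leibniz)

text \<open>Since \<open>c = [a,b]\<close>, the derivation property gives \<open>[c,x]\<close>. The left product \<open>[x,[a,b]]\<close> is
  expanded by the same identity; the central errors in \<open>[x,a]\<close> and \<open>[x,b]\<close> are killed by the
  brackets with \<open>b\<close> and \<open>a\<close>.\<close>

lemma br_centre:
  assumes f: "heisenberg_basis a b c"
    and ax: "br a x = scale \<mu> a + scale \<nu> b + scale \<alpha> c"
    and bx: "br b x = scale \<kappa> b + scale \<beta> c"
  shows "br c x = scale (\<kappa> + \<mu>) c" "br x c = - scale (\<kappa> + \<mu>) c"
proof -
  note D = heisenberg_basisD[OF f]
  have "br a (br b x) = br (br a b) x - br (br a x) b" by (rule leibniz)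
  then show cx: "br c x = scale (\<kappa> + \<mu>) c"
    using D by (simp add: ax bx br_simps algebra_simps)
  obtain k where k: "br x a = - br a x + scale k c"
    using bracket_skew_mod_centre[OF f D(1)] .
  obtain l where l: "br x b = - br b x + scale l c"
    using bracket_skew_mod_centre[OF f D(2)] .
  have "br x (br a b) = br (br x a) b - br (br x b) a" by (rule leibniz)
  then have "br x c = - scale \<mu> c - scale \<kappa> c"
    using D by (simp add: ax bx k l br_simps)
  then show "br x c = - scale (\<kappa> + \<mu>) c" by (simp add: scale_left_distrib)
qed

text \<open>If both eigenvalues vanish, the lower central series descends from the whole algebra through
  the spans of \<open>{b, c}\<close> and \<open>{c}\<close> to zero.\<close>

lemma not_strictly_triangular:
  assumes f: "heisenberg_basis a b c" and x: "x \<notin> N"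
    and ax: "br a x = scale \<mu> a + scale \<nu> b + scale \<alpha> c"
    and bx: "br b x = scale \<kappa> b + scale \<beta> c"
  shows "\<kappa> \<noteq> 0 \<or> \<mu> \<noteq> 0"
proof (rule ccontr)
  assume "\<not> (\<kappa> \<noteq> 0 \<or> \<mu> \<noteq> 0)"
  then have z: "\<kappa> = 0" "\<mu> = 0" by auto
  note D = heisenberg_basisD[OF f]
  obtain k where k: "br x a = - br a x + scale k c"
    using bracket_skew_mod_centre[OF f D(1)] .
  obtain l where l: "br x b = - br b x + scale l c"
    using bracket_skew_mod_centre[OF f D(2)] .
  obtain d where d: "br x x = scale d c" using square_central[OF f] .
  note table = D ax bx k l d br_centre[OF f ax bx] z
  have coords: "\<exists>p q r t. u = scale p a + scale q b + scale r c + scale t x" for u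
  proof -
    obtain t where "u - scale t x \<in> N" using codim_one[OF x] by blast
    with f obtain p q r where "u - scale t x = scale p a + scale q b + scale r c"
      by (rule heisenberg_coordinates)
    then show ?thesis by (metis diff_add_cancel)
  qed
  have "br u v \<in> span {b, c}" for u v
  proof -
    have "b \<in> span {b, c}" "c \<in> span {b, c}" by (simp_all add: span_base)
    moreover obtain p q r t p' q' r' t' where
      "u = scale p a + scale q b + scale r c + scale t x"
      "v = scale p' a + scale q' b + scale r' c + scale t' x"
      using coords by metis
    ultimately show ?thesis
      by (simp add: br_simps table span_add span_scale span_neg span_diff)
  qed
  then have 1: "lower_series UNIV (Suc 0) \<subseteq> span {b, c}"
    by (subst lower_series.simps(2)) (intro bracket_space_least subspace_span)
  have "br u v \<in> span {c}" if "u \<in> span {b, c}" for u v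
  proof -
    obtain q r where "u = scale q b + scale r c"
      using \<open>u \<in> span {b, c}\<close> by (rule span_pairE)
    moreover obtain p' q' r' t' where
      "v = scale p' a + scale q' b + scale r' c + scale t' x"
      using coords by metis
    moreover have "c \<in> span {c}" by (simp add: span_base)
    ultimately show ?thesis
      by (simp add: br_simps table span_add span_scale span_neg span_diff)
  qed
  then have 2: "lower_series UNIV (Suc (Suc 0)) \<subseteq> span {c}"
    using 1 by (subst lower_series.simps(2)) (intro bracket_space_least subspace_span, blast)
  have "br u v \<in> {0}" if "u \<in> span {c}" for u v
  proof -
    obtain r where "u = scale r c"
      using \<open>u \<in> span {c}\<close> by (auto simp: span_singleton)
    moreover obtain p' q' r' t' where
      "v = scale p' a + scale q' b + scale r' c + scale t' x"
      using coords by metis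
    ultimately show ?thesis
      by (simp add: br_simps table)
  qed
  then have "lower_series UNIV (Suc (Suc (Suc 0))) \<subseteq> {0}"
    using 2 by (subst lower_series.simps(2)) (intro bracket_space_least subspace_single_0, blast)
  moreover have "0 \<in> lower_series UNIV (Suc (Suc (Suc 0)))"
    by (simp add: bracket_space_def span_zero)
  ultimately have "nilpotent UNIV" unfolding nilpotent_def by blast
  with not_nilpotent show False ..
qed

text \<open>Any change of basis in the plane of \<open>a\<close> and \<open>b\<close> is permitted; the bracket of the new vectors
  multiplies \<open>c\<close> by the determinant.\<close>

lemma heisenberg_basis_change:
  assumes f: "heisenberg_basis a b c" and det: "p * s - q * r \<noteq> 0"
  shows "heisenberg_basis (scale p a + scale q b) (scale r a + scale s b) (scale (p * s - q * r) c)"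
    (is "heisenberg_basis ?a ?b ?c")
proof -
  note D = heisenberg_basisD[OF f]
  define i where "i = inverse (p * s - q * r)"
  have "\<exists>u v w. n = scale u ?a + scale v ?b + scale w ?c" if n: "n \<in> N" for n
  proof -
    from f n obtain u v w where n: "n = scale u a + scale v b + scale w c"
      by (rule heisenberg_coordinates)
    have i: "i * (p * s - q * r) = 1" using det by (simp add: i_def)
    \<comment> \<open>coordinates with respect to the new basis, by Cramer's rule\<close>
    have u: "(u * s - v * r) * i * p + (v * p - u * q) * i * r = u * (i * (p * s - q * r))"
      by (simp add: algebra_simps)
    have v: "(u * s - v * r) * i * q + (v * p - u * q) * i * s = v * (i * (p * s - q * r))"
      by (simp add: algebra_simps)
    have "scale ((u * s - v * r) * i) ?a + scale ((v * p - u * q) * i) ?b + scale (w * i) ?c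
      = scale ((u * s - v * r) * i * p + (v * p - u * q) * i * r) a
      + scale ((u * s - v * r) * i * q + (v * p - u * q) * i * s) b
      + scale (w * (i * (p * s - q * r))) c"
      by (simp add: scale_right_distrib scale_left_distrib add_ac mult.assoc)
    also have "\<dots> = n" unfolding u v i n by simp
    finally show ?thesis by metis
  qed
  then show ?thesis
    unfolding heisenberg_basis_def using D det
    by (auto simp: br_simps N_closed algebra_simps)
qed

text \<open>An eigenvector modulo \<open>c\<close> is taken as second basis vector.\<close>

lemma triangular_basis:
  assumes f: "heisenberg_basis a b c"
  obtains a' b' c' \<kappa> \<mu> \<nu> \<alpha> \<beta> where "heisenberg_basis a' b' c'"
    "br a' x = scale \<mu> a' + scale \<nu> b' + scale \<alpha> c'"
    "br b' x = scale \<kappa> b' + scale \<beta> c'"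
proof -
  note D = heisenberg_basisD[OF f]
  from f br_N(1)[OF D(1)] obtain a1 a2 a3 where ax: "br a x = scale a1 a + scale a2 b + scale a3 c"
    by (rule heisenberg_coordinates)
  from f br_N(1)[OF D(2)] obtain b1 b2 b3 where bx: "br b x = scale b1 a + scale b2 b + scale b3 c"
    by (rule heisenberg_coordinates)
  show thesis
  proof (cases "a2 = 0")
    case True
    have "heisenberg_basis b (- a) c"
      using heisenberg_basis_change[OF f, of 0 0 1 "- 1"] by simp
    then show thesis
      by (rule that[where \<mu> = b2 and \<nu> = "- b1" and \<alpha> = b3 and \<kappa> = a1 and \<beta> = "- a3"])
        (simp_all add: br_simps ax bx True)
  next
    case False
    obtain l where l: "l * l = (a1 + b2) * l - (a1 * b2 - a2 * b1)"
      by (rule complex_quadratic_root)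
    \<comment> \<open>an eigenvector of the matrix with columns \<open>(a1, a2)\<close>, \<open>(b1, b2)\<close> for the eigenvalue \<open>l\<close>\<close>
    define v where "v = scale (l - b2) a + scale a2 b"
    have f': "heisenberg_basis a v (scale a2 c)"
      using heisenberg_basis_change[OF f, of 1 a2 0 "l - b2"] False by (simp add: v_def)
    have eig: "(l - b2) * a1 + a2 * b1 = l * (l - b2)"
      using l by (simp add: algebra_simps)
    have "br v x = scale ((l - b2) * a1 + a2 * b1) a + scale (l * a2) b
        + scale ((l - b2) * a3 + a2 * b3) c"
      by (simp add: v_def br_simps ax bx scale_left_distrib scale_right_distrib algebra_simps)
    also have "\<dots> = scale l v + scale (((l - b2) * a3 + a2 * b3) / a2) (scale a2 c)"
      using False unfolding eig by (simp add: v_def scale_right_distrib)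
    finally have vx: "br v x = scale l v + scale (((l - b2) * a3 + a2 * b3) / a2) (scale a2 c)" .
    have "br a x = scale (a1 - (l - b2)) a + scale 1 v + scale (a3 / a2) (scale a2 c)"
      using False by (simp add: ax v_def scale_left_diff_distrib)
    then show thesis using that f' vx by blast
  qed
qed

text \<open>Right multiplication by \<open>\<beta> a - \<alpha> b\<close> sends \<open>a\<close> to \<open>- \<alpha> c\<close> and \<open>b\<close> to \<open>- \<beta> c\<close>, so adding this
  element to the generator clears the components along \<open>c\<close>.\<close>

lemma triangular_generator:
  assumes f: "heisenberg_basis a b c" and x: "x \<notin> N"
  obtains a' b' c' y \<kappa> \<mu> \<nu> where "heisenberg_basis a' b' c'" "y \<notin> N"
    "br a' y = scale \<mu> a' + scale \<nu> b'" "br b' y = scale \<kappa> b'" "\<kappa> \<noteq> 0 \<or> \<mu> \<noteq> 0"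
proof -
  obtain a' b' c' \<kappa> \<mu> \<nu> \<alpha> \<beta> where f': "heisenberg_basis a' b' c'"
    and ax: "br a' x = scale \<mu> a' + scale \<nu> b' + scale \<alpha> c'"
    and bx: "br b' x = scale \<kappa> b' + scale \<beta> c'"
    using triangular_basis[OF f] .
  note D = heisenberg_basisD[OF f']
  let ?n = "scale \<beta> a' - scale \<alpha> b'"
  have "?n \<in> N" by (intro N_closed D)
  then have y: "x + ?n \<notin> N" using x N_closed(3)[of "x + ?n" ?n] by auto
  have "br a' (x + ?n) = scale \<mu> a' + scale \<nu> b'" "br b' (x + ?n) = scale \<kappa> b'"
    by (simp_all add: br_simps ax bx D)
  from that[OF f' y this not_strictly_triangular[OF f' x ax bx]] show thesis .
qed

text \<open>Write \<open>[x,a] = - [a,x] + k c\<close> and \<open>[x,b] = - [b,x] + l c\<close>. That symmetrized brackets are right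
  annihilators means that \<open>k\<close>, \<open>l\<close> and the coefficient of \<open>[x,x]\<close> vanish unless the trace
  \<open>\<kappa> + \<mu>\<close> is zero. In that remaining case the matrix has the non-zero eigenvalues \<open>\<kappa>\<close> and \<open>- \<kappa>\<close>, and
  the Leibniz identity for \<open>x, b, x\<close> and \<open>x, a, x\<close> says that the functional \<open>(k, l)\<close> vanishes on the
  range of this invertible matrix.\<close>

lemma multiplication_table:
  assumes f: "heisenberg_basis a b c" and x: "x \<notin> N"
    and ax: "br a x = scale \<mu> a + scale \<nu> b" and bx: "br b x = scale \<kappa> b"
    and nz: "\<kappa> \<noteq> 0 \<or> \<mu> \<noteq> 0"
  shows "br x a = - br a x" "br x b = - br b x"
    "br c x = scale (\<kappa> + \<mu>) c" "br x c = - scale (\<kappa> + \<mu>) c"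
    "\<exists>d. br x x = scale d c \<and> d * (\<kappa> + \<mu>) = 0"
proof -
  note D = heisenberg_basisD[OF f]
  have ax': "br a x = scale \<mu> a + scale \<nu> b + scale 0 c" and bx': "br b x = scale \<kappa> b + scale 0 c"
    by (simp_all add: ax bx)
  show c: "br c x = scale (\<kappa> + \<mu>) c" "br x c = - scale (\<kappa> + \<mu>) c"
    by (rule br_centre[OF f ax' bx'])+
  obtain k where k: "br x a = - br a x + scale k c"
    using bracket_skew_mod_centre[OF f D(1)] .
  obtain l where l: "br x b = - br b x + scale l c"
    using bracket_skew_mod_centre[OF f D(2)] .
  obtain d where d: "br x x = scale d c" using square_central[OF f] .
  have "br x (br x x) = 0" by (simp add: leibniz)
  then have d': "d * (\<kappa> + \<mu>) = 0" using D(4) by (auto simp: d br_simps c)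
  with d show "\<exists>d. br x x = scale d c \<and> d * (\<kappa> + \<mu>) = 0" by blast
  have "br x (br x a + br a x) = 0" "br x (br x b + br b x) = 0"
    by (rule br_symmetrized_right)+
  then have tr: "k * (\<kappa> + \<mu>) = 0" "l * (\<kappa> + \<mu>) = 0" using D(4) by (auto simp: k l br_simps c)
  have "br x (br b x) = br (br x b) x - br (br x x) b" "br x (br a x) = br (br x a) x - br (br x x) a"
    by (rule leibniz)+
  then have "scale (\<kappa> * l) c = scale (l * (\<kappa> + \<mu>)) c"
    "scale (\<mu> * k + \<nu> * l) c = scale (k * (\<kappa> + \<mu>)) c"
    using D by (simp_all add: ax bx k l d br_simps c algebra_simps)
  then have kl: "\<kappa> * l = 0" "\<mu> * k + \<nu> * l = 0" using tr D(4) by auto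
  have "l = 0" using kl(1) tr(2) nz by auto
  moreover from this have "k = 0" using kl(2) tr(1) nz by auto
  ultimately show "br x a = - br a x" "br x b = - br b x" using k l by auto
qed

text \<open>Here the multiplication table of the algebra in a basis \<open>a, b, c, x\<close> is compared with the one of
  \<open>L\<close>; the isomorphism is the coordinate map, the inverse of \<open>\<phi>\<close>.\<close>

lemma isomorphic_by_basis:
  fixes L :: "complex ^ 4 \<Rightarrow> complex ^ 4 \<Rightarrow> complex ^ 4"
  assumes f: "heisenberg_basis a b c" and x: "x \<notin> N"
  defines "\<phi> \<equiv> \<lambda>u. scale (u $ 1) a + scale (u $ 2) b + scale (u $ 3) c + scale (u $ 4) x"
  assumes L: "\<And>u v. \<phi> (L u v) = br (\<phi> u) (\<phi> v)"
  shows "algebra_isomorphic scale UNIV br (*s) UNIV L"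
proof -
  note D = heisenberg_basisD[OF f]
  have add: "\<phi> (u + v) = \<phi> u + \<phi> v" for u v
    by (simp add: \<phi>_def algebra_simps)
  have scl: "\<phi> (k *s u) = scale k (\<phi> u)" for k u
    by (simp add: \<phi>_def algebra_simps)
  have "inj \<phi>"
  proof (rule injI)
    fix u v assume "\<phi> u = \<phi> v"
    define w where "w = u - v"
    have "\<phi> w + \<phi> v = \<phi> u" unfolding add[symmetric] w_def by simp
    with \<open>\<phi> u = \<phi> v\<close> have 0: "\<phi> w = 0" by simp
    then have "scale (w $ 4) x = - (scale (w $ 1) a + scale (w $ 2) b + scale (w $ 3) c)"
      unfolding \<phi>_def by (metis eq_neg_iff_add_eq_0 add.commute)
    also have "\<dots> \<in> N" by (intro N_closed D)
    finally have w4: "w $ 4 = 0" by (rule scale_notin_N[OF x])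
    have "br a (\<phi> w) = 0" "br b (\<phi> w) = 0" using 0 by (simp_all add: br_simps)
    then have w: "w $ 1 = 0" "w $ 2 = 0" using w4 D by (simp_all add: \<phi>_def br_simps)
    then have "w $ 3 = 0" using 0 w4 D(4) by (simp add: \<phi>_def)
    with w w4 show "u = v" by (simp add: w_def vec_eq_iff forall_4)
  qed
  moreover have "surj \<phi>"
  proof (rule surjI)
    fix u
    obtain t where "u - scale t x \<in> N" using codim_one[OF x] by blast
    with f obtain p q r where pqr: "u - scale t x = scale p a + scale q b + scale r c"
      by (rule heisenberg_coordinates)
    have "\<exists>w. \<phi> w = u"
      by (rule exI[of _ "p *s e 1 + q *s e 2 + r *s e 3 + t *s e 4"])
        (simp add: \<phi>_def axis_def pqr[symmetric])
    then show "\<phi> (inv \<phi> u) = u" by (metis f_inv_into_f rangeI)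
  qed
  ultimately have bij: "bij \<phi>" by (rule bijI)
  then have inv: "\<phi> (inv \<phi> u) = u" "inv \<phi> (\<phi> w) = w" for u w
    by (simp_all add: bij_is_surj surj_f_inv_f bij_is_inj)
  show ?thesis
    unfolding algebra_isomorphic_def
  proof (intro exI[of _ "inv \<phi>"] conjI ballI allI)
    show "bij (inv \<phi>)" using bij by (rule bij_imp_bij_inv)
  qed (metis add inv, metis scl inv, metis L inv)
qed

text \<open>The diagonalizable case: the generator is rescaled so that the first eigenvalue becomes \<open>1\<close>.
  When the square \<open>[y,y] = d c\<close> of the new generator is not zero, scaling \<open>a\<close> and \<open>c\<close> by \<open>d\<close>
  normalizes it.\<close>

lemma isomorphic_L1_or_L2:
  assumes f: "heisenberg_basis a b c" and x: "x \<notin> N"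
    and ax: "br a x = scale \<mu> a" and bx: "br b x = scale \<kappa> b" and nz: "\<mu> \<noteq> 0"
  shows "(\<exists>\<gamma>. algebra_isomorphic scale UNIV br (*s) UNIV (L1 \<gamma>)) \<or>
         algebra_isomorphic scale UNIV br (*s) UNIV L2"
proof -
  define y where "y = scale (inverse \<mu>) x"
  define \<gamma> where "\<gamma> = inverse \<mu> * \<kappa>"
  have y: "y \<notin> N" using scale_notin_N[OF x, of "inverse \<mu>"] nz by (auto simp: y_def)
  have ay: "br a y = a" using ax nz by (simp add: y_def br_simps)
  have bY: "br b y = scale \<gamma> b" using bx by (simp add: y_def \<gamma>_def br_simps)
  note left = multiplication_table[OF f y, of 1 0 \<gamma>, simplified, OF ay bY]
  note D = heisenberg_basisD[OF f]
  from left(5) obtain d where d: "br y y = scale d c" "d = 0 \<or> \<gamma> + 1 = 0" by blast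
  show ?thesis
  proof (cases "d = 0")
    case True
    have "algebra_isomorphic scale UNIV br (*s) UNIV (L1 \<gamma>)"
      by (rule isomorphic_by_basis[OF f y])
        (simp add: br_simps D left(1-4) ay bY d True L1_def table_simps algebra_simps)
    then show ?thesis by blast
  next
    case False
    then have \<gamma>: "\<gamma> = - 1" using d(2) by (simp add: eq_neg_iff_add_eq_0)
    have f': "heisenberg_basis (scale d a) b (scale d c)"
      using heisenberg_basis_change[OF f, of d 1 0 0] False by simp
    have "algebra_isomorphic scale UNIV br (*s) UNIV L2"
      by (rule isomorphic_by_basis[OF f' y])
        (simp add: br_simps D left(1-4) ay bY d \<gamma> L2_def table_simps algebra_simps)
    then show ?thesis by blast
  qed
qed

text \<open>The case of a Jordan block: both the eigenvalue and the entry above it are normalized to \<open>1\<close>.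
  The trace is then \<open>2\<close>, which forces the square of the generator to vanish.\<close>

lemma isomorphic_L3:
  assumes f: "heisenberg_basis a b c" and x: "x \<notin> N"
    and ax: "br a x = scale \<kappa> a + scale \<nu> b" and bx: "br b x = scale \<kappa> b"
    and nz: "\<kappa> \<noteq> 0" "\<nu> \<noteq> 0"
  shows "algebra_isomorphic scale UNIV br (*s) UNIV L3"
proof -
  define y where "y = scale (inverse \<kappa>) x"
  define k where "k = inverse \<kappa> * \<nu>"
  have y: "y \<notin> N" using scale_notin_N[OF x, of "inverse \<kappa>"] nz by (auto simp: y_def)
  have f': "heisenberg_basis a (scale k b) (scale k c)"
    using heisenberg_basis_change[OF f, of 1 k 0 0] nz by (simp add: k_def)
  define b' c' where "b' = scale k b" and "c' = scale k c"
  note f' = f'[folded b'_def c'_def]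
  have ay: "br a y = a + b'" using ax nz
    by (simp add: y_def b'_def k_def br_simps scale_right_distrib)
  have bY: "br b' y = b'" using bx nz by (simp add: y_def b'_def br_simps)
  note left = multiplication_table[OF f' y, of 1 1 1, simplified, OF ay bY]
  note D = heisenberg_basisD[OF f']
  show ?thesis
    by (rule isomorphic_by_basis[OF f' y])
      (simp add: br_simps D left ay bY L3_def table_simps algebra_simps)
qed

lemma classification:
  assumes f: "heisenberg_basis a b c" and x: "x \<notin> N"
  shows "(\<exists>\<gamma>. algebra_isomorphic scale UNIV br (*s) UNIV (L1 \<gamma>)) \<or>
         algebra_isomorphic scale UNIV br (*s) UNIV L2 \<or>
         algebra_isomorphic scale UNIV br (*s) UNIV L3"
proof -
  obtain a b c x \<kappa> \<mu> \<nu> where f: "heisenberg_basis a b c" and x: "x \<notin> N"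
    and ax: "br a x = scale \<mu> a + scale \<nu> b" and bx: "br b x = scale \<kappa> b"
    and nz: "\<kappa> \<noteq> 0 \<or> \<mu> \<noteq> 0"
    using triangular_generator[OF f x] .
  show ?thesis
  proof (cases "\<kappa> = \<mu> \<and> \<nu> \<noteq> 0")
    case True
    then show ?thesis using isomorphic_L3[OF f x, of \<kappa> \<nu>] ax bx nz by auto
  next
    case False
    \<comment> \<open>\<open>a + k b\<close> is an eigenvector for \<open>\<mu>\<close>; if \<open>\<mu> = \<kappa>\<close> then \<open>\<nu> = 0\<close>, and the quotient below is
        \<open>0\<close>, which is the right value\<close>
    define k where "k = \<nu> / (\<mu> - \<kappa>)"
    have k: "k * \<mu> = \<nu> + k * \<kappa>"
    proof (cases "\<mu> = \<kappa>")
      case False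
      then have "k * (\<mu> - \<kappa>) = \<nu>" by (simp add: k_def)
      then show ?thesis by (simp add: algebra_simps)
    qed (use False k_def in auto)
    define a' where "a' = a + scale k b"
    have f': "heisenberg_basis a' b c"
      using heisenberg_basis_change[OF f, of 1 1 k 0] by (simp add: a'_def)
    have "br a' x = scale \<mu> a + scale (\<nu> + k * \<kappa>) b"
      by (simp add: a'_def br_simps ax bx scale_left_distrib)
    also have "\<dots> = scale \<mu> a'"
      unfolding k[symmetric] by (simp add: a'_def scale_right_distrib mult.commute)
    finally have a'x: "br a' x = scale \<mu> a'" .
    show ?thesis
    proof (cases "\<mu> = 0")
      case False
      then show ?thesis using isomorphic_L1_or_L2[OF f' x a'x bx] by blast
    next
      case True
      \<comment> \<open>the eigenvalue \<open>\<kappa>\<close> is the non-zero one, so the two eigenvectors are interchanged\<close>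
      have "heisenberg_basis b (- a') c"
        using heisenberg_basis_change[OF f', of 0 0 1 "- 1"] by simp
      from isomorphic_L1_or_L2[OF this x bx] True nz a'x show ?thesis
        by (metis br_left.neg scale_minus_right)
    qed
  qed
qed

end

text \<open>The images of the standard basis under the inverse of an isomorphism onto \<open>lambda3\<close> form a
  basis of the nilradical, and counting dimensions shows that any single vector outside
  completes it to a basis of the algebra.\<close>

lemma lambda3_nilradical_heisenberg_extension:
  fixes scale :: "complex \<Rightarrow> 'a::ab_group_add \<Rightarrow> 'a" and br :: "'a \<Rightarrow> 'a \<Rightarrow> 'a"
  assumes L: "leibniz_algebra scale br"
    and dim: "vector_space.dim scale (UNIV :: 'a set) = 4"
    and N: "leibniz_algebra.is_nilradical scale br N"
    and iso: "algebra_isomorphic scale N br (*s) UNIV lambda3"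
  obtains a b c x where "heisenberg_extension scale br N"
    "heisenberg_extension.heisenberg_basis scale br N a b c" "x \<notin> N"
proof -
  interpret leibniz_algebra scale br by fact
  obtain B where B: "independent B" "UNIV \<subseteq> span B" "card B = 4"
    using basis_exists[of UNIV] dim by metis
  interpret finite_dimensional_vector_space scale B
    by unfold_locales (use B in \<open>auto intro: card_ge_0_finite\<close>)
  from N have ideal: "two_sided_ideal N" and nilp: "nilpotent N"
    and maxi: "\<And>M. two_sided_ideal M \<Longrightarrow> nilpotent M \<Longrightarrow> N \<subseteq> M \<Longrightarrow> M = N"
    by (auto simp: is_nilradical_def)
  have sub: "subspace N" using ideal by (simp add: two_sided_ideal_def)
  from iso obtain f where f: "bij_betw f N UNIV"
    and f_add: "\<And>x y. x \<in> N \<Longrightarrow> y \<in> N \<Longrightarrow> f (x + y) = f x + f y"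
    and f_scale: "\<And>k x. x \<in> N \<Longrightarrow> f (scale k x) = k *s f x"
    and f_br: "\<And>x y. x \<in> N \<Longrightarrow> y \<in> N \<Longrightarrow> f (br x y) = lambda3 (f x) (f y)"
    unfolding algebra_isomorphic_def by blast
  define g where "g = inv_into N f"
  have g: "g v \<in> N" "f (g v) = v" for v
    using f by (auto simp: g_def bij_betw_def inv_into_into f_inv_into_f)
  have gf: "g (f n) = n" if "n \<in> N" for n
    using f that by (simp add: g_def bij_betw_inv_into_left)
  have g_add: "g (u + v) = g u + g v" for u v
    using gf[of "g u + g v"] by (simp add: f_add g subspace_add[OF sub])
  have g_scale: "g (k *s v) = scale k (g v)" for k v
    using gf[of "scale k (g v)"] by (simp add: f_scale g subspace_scale[OF sub])
  have g_br: "br (g u) (g v) = g (lambda3 u v)" for u v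
    using gf[of "br (g u) (g v)"] g ideal by (simp add: f_br two_sided_ideal_def)
  define a b c where "a = g (e 1)" and "b = g (e 2)" and "c = g (e 3)"
  note abc = a_def b_def c_def
  have g0: "g 0 = 0" using g_scale[of 0 0] by simp
  have gneg: "g (- v) = - g v" for v using g_scale[of "- 1" v] by simp
  have coords: "\<exists>p q r. n = scale p a + scale q b + scale r c" if "n \<in> N" for n
  proof -
    have "f n = (f n $ 1) *s e 1 + (f n $ 2) *s e 2 + (f n $ 3) *s e 3"
      by (simp add: vec_eq_iff forall_3 axis_def)
    then have "g (f n) = scale (f n $ 1) a + scale (f n $ 2) b + scale (f n $ 3) c"
      by (metis abc g_add g_scale)
    then show ?thesis using gf[OF that] by metis
  qed
  have "c \<noteq> 0"
  proof
    assume "c = 0"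
    then have "e 3 = f (scale 0 0)" using g(2)[of "e 3"] by (simp add: c_def)
    also have "\<dots> = 0" using f_scale[of 0 0] subspace_0[OF sub] by (simp del: scale_zero_right)
    finally show False by (simp add: vec_eq_iff forall_3 axis_def)
  qed
  have tab: "lambda3 (e 1) (e 2) = e 3" "lambda3 (e 2) (e 1) = - e 3"
    "lambda3 (e 1) (e 1) = 0" "lambda3 (e 2) (e 2) = 0"
    "lambda3 (e 1) (e 3) = 0" "lambda3 (e 2) (e 3) = 0" "lambda3 (e 3) (e 3) = 0"
    "lambda3 (e 3) (e 1) = 0" "lambda3 (e 3) (e 2) = 0"
    by (simp_all add: lambda3_def table_simps)
  note prods = abc g_br tab g0 gneg
  have inN: "a \<in> N" "b \<in> N" "c \<in> N" using g by (simp_all add: abc)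
  have ab: "br a b = c" "br a c = 0" "br c b = 0" "br b b = 0" by (simp_all add: prods)
  have indep: "independent {a, b, c}"
  proof -
    have "b \<notin> span {c}"
    proof
      assume "b \<in> span {c}"
      then obtain k where "b = scale k c" by (auto simp: span_singleton)
      with ab(1) have "br a (scale k c) = c" by simp
      with ab(2) \<open>c \<noteq> 0\<close> show False by (simp add: br_scale_right)
    qed
    moreover have "a \<notin> span {b, c}"
    proof
      assume "a \<in> span {b, c}"
      then obtain q r where "a = scale q b + scale r c"
        by (rule span_pairE)
      with ab(1) have "br (scale q b + scale r c) b = c" by simp
      with ab(3,4) \<open>c \<noteq> 0\<close> show False by (simp add: br_add_left br_scale_left)
    qed
    ultimately show ?thesis using \<open>c \<noteq> 0\<close> by (intro independent_insertI) (auto simp: independent_empty)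
  qed
  have spanN: "span {a, b, c} = N"
  proof
    show "span {a, b, c} \<subseteq> N" by (rule span_minimal) (use inN sub in auto)
    show "N \<subseteq> span {a, b, c}"
    proof
      fix n assume "n \<in> N"
      then obtain p q r where "n = scale p a + scale q b + scale r c" using coords by blast
      then show "n \<in> span {a, b, c}" by (simp add: span_add span_scale span_base)
    qed
  qed
  have card3: "card {a, b, c} \<le> 3" by (simp add: card_insert_if)
  have "N \<noteq> UNIV"
  proof
    assume "N = UNIV"
    then have "dim (UNIV :: 'a set) = card {a, b, c}"
      using indep spanN by (metis dim_span dim_eq_card_independent)
    then show False using dim card3 by simp
  qed
  then obtain x where x: "x \<notin> N" by blast
  have codim: "\<exists>t. v - scale t y \<in> N" if y: "y \<notin> N" for y v
  proof -
    have "a \<noteq> b" "a \<noteq> c" "b \<noteq> c" using ab \<open>c \<noteq> 0\<close> by auto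
    moreover have "y \<notin> {a, b, c}" using y inN by auto
    ultimately have "card {y, a, b, c} = 4" by simp
    moreover have "independent {y, a, b, c}"
      by (rule independent_insertI) (use y spanN indep in auto)
    ultimately have "UNIV \<subseteq> span {y, a, b, c}"
      using dim by (intro card_ge_dim_independent) auto
    then have "v \<in> span (insert y {a, b, c})" by auto
    then show ?thesis unfolding span_breakdown_eq spanN .
  qed
  have H: "heisenberg_extension scale br N"
  proof unfold_locales
    show "\<not> nilpotent UNIV"
    proof
      assume "nilpotent UNIV"
      then have "UNIV = N" by (intro maxi) (auto simp: two_sided_ideal_def)
      with x show False by blast
    qed
  qed (use ideal codim in auto)
  interpret heisenberg_extension scale br N by (rule H)
  have "heisenberg_basis a b c"
    unfolding heisenberg_basis_def using inN coords \<open>c \<noteq> 0\<close> by (simp add: prods)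
  with H x show thesis by (intro that)
qed

section \<open>Isomorphism invariants\<close>

definition right_mult_matrix ::
  "(complex ^ 4 \<Rightarrow> complex ^ 4 \<Rightarrow> complex ^ 4) \<Rightarrow> complex ^ 4 \<Rightarrow> complex ^ 4 ^ 4" where
  "right_mult_matrix B u = matrix (\<lambda>v. B v u)"

lemma isomorphic4E:
  assumes "isomorphic4 B B'"
  obtains f where "bij f" "Vector_Spaces.linear (*s) (*s) f" "\<forall>u v. f (B u v) = B' (f u) (f v)"
proof -
  from assms obtain f where "bij f" "\<And>x y. f (x + y) = f x + f y"
    "\<And>c x. f (c *s x) = c *s f x" "\<And>u v. f (B u v) = B' (f u) (f v)"
    unfolding algebra_isomorphic_def by auto
  then show thesis
    by (intro that[of f]) (auto simp: Vector_Spaces.linear_iff vec.vector_space_axioms)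
qed

text \<open>The intertwining relation \<open>f \<circ> R\<^sub>u = R'\<^bsub>f u\<^esub> \<circ> f\<close> makes the two matrices similar.\<close>

lemma isomorphism_preserves_traces:
  assumes B: "leibniz_algebra (*s) B" and B': "leibniz_algebra (*s) B'"
    and bij: "bij f" and lin: "Vector_Spaces.linear (*s) (*s) f"
    and f: "\<forall>u v. f (B u v) = B' (f u) (f v)"
  defines "M \<equiv> right_mult_matrix B" and "M' \<equiv> right_mult_matrix B'"
  shows "trace (M u) = trace (M' (f u))" "trace (M u ** M u) = trace (M' (f u) ** M' (f u))"
proof -
  have lB: "Vector_Spaces.linear (*s) (*s) (\<lambda>v. B v u)" for u
    using B by (auto simp: Vector_Spaces.linear_iff vec.vector_space_axioms
        leibniz_algebra_def leibniz_algebra_axioms_def)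
  have lB': "Vector_Spaces.linear (*s) (*s) (\<lambda>v. B' v u)" for u
    using B' by (auto simp: Vector_Spaces.linear_iff vec.vector_space_axioms
        leibniz_algebra_def leibniz_algebra_axioms_def)
  define P where "P = matrix f"
  have "f \<circ> (\<lambda>v. B v u) = (\<lambda>v. B' v (f u)) \<circ> f" by (simp add: fun_eq_iff f)
  then have PM: "P ** M u = M' (f u) ** P"
    unfolding P_def M_def M'_def right_mult_matrix_def
    by (metis matrix_compose_gen lin lB lB')
  obtain h where h: "Vector_Spaces.linear (*s) (*s) h" "h \<circ> f = id"
    using vec.linear_injective_left_inverse[OF lin bij_is_inj[OF bij]] by blast
  define Q where "Q = matrix h"
  have QP: "Q ** P = mat 1"
    unfolding P_def Q_def using matrix_compose_gen[OF lin h(1)] h(2) by (simp add: matrix_id_mat_1)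
  then have PQ: "P ** Q = mat 1" using matrix_left_right_inverse by blast
  have conj: "trace A = trace A'" if "P ** A = A' ** P" for A A' :: "complex ^ 4 ^ 4"
  proof -
    have "trace A = trace (Q ** (P ** A))" by (simp add: matrix_mul_assoc QP)
    also have "\<dots> = trace ((A' ** P) ** Q)" unfolding that by (rule trace_mul_sym)
    also have "\<dots> = trace A'" by (simp add: matrix_mul_assoc[symmetric] PQ)
    finally show ?thesis .
  qed
  show "trace (M u) = trace (M' (f u))" by (rule conj) (rule PM)
  show "trace (M u ** M u) = trace (M' (f u) ** M' (f u))"
    by (rule conj) (metis PM matrix_mul_assoc)
qed

lemma traces_L1:
  "trace (right_mult_matrix (L1 \<gamma>) u) = 2 * (1 + \<gamma>) * u $ 4"
  "trace (right_mult_matrix (L1 \<gamma>) u ** right_mult_matrix (L1 \<gamma>) u) = 2 * (1 + \<gamma> + \<gamma>\<^sup>2) * (u $ 4)\<^sup>2"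
  by (simp_all add: trace_def right_mult_matrix_def matrix_def matrix_matrix_mult_def sum_4
      L1_def table_simps algebra_simps power2_eq_square)

lemma traces_L3:
  "trace (right_mult_matrix L3 u) = 4 * u $ 4"
  "trace (right_mult_matrix L3 u ** right_mult_matrix L3 u) = 6 * (u $ 4)\<^sup>2"
  by (simp_all add: trace_def right_mult_matrix_def matrix_def matrix_matrix_mult_def sum_4
      L3_def table_simps algebra_simps power2_eq_square)

text \<open>Traces are compared at \<open>u = x\<close>, whose image has some fourth coordinate \<open>s\<close>. The factor \<open>s\<close> is not
  zero because \<open>1 + \<gamma>\<close> and \<open>1 + \<gamma> + \<gamma>\<^sup>2\<close> have no common root.\<close>

lemma L1_isomorphic_only_inverse:
  assumes "isomorphic4 (L1 \<gamma>) (L1 \<delta>)"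
  shows "\<gamma> = \<delta> \<or> \<gamma> * \<delta> = 1"
proof -
  obtain f where f: "bij f" "Vector_Spaces.linear (*s) (*s) f"
    "\<forall>u v. f (L1 \<gamma> u v) = L1 \<delta> (f u) (f v)"
    using isomorphic4E[OF assms] .
  define s where "s = f (e 4) $ 4"
  note tr = isomorphism_preserves_traces[OF leibniz_L1 leibniz_L1 f, of "e 4"]
  have "2 * (1 + \<gamma>) = 2 * ((1 + \<delta>) * s)"
    using tr(1) by (simp add: traces_L1 s_def axis_def algebra_simps)
  then have 1: "1 + \<gamma> = (1 + \<delta>) * s" unfolding mult_cancel_left by simp
  have "2 * (1 + \<gamma> + \<gamma>\<^sup>2) = 2 * ((1 + \<delta> + \<delta>\<^sup>2) * s\<^sup>2)"
    using tr(2) by (simp add: traces_L1 s_def axis_def algebra_simps)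
  then have 2: "1 + \<gamma> + \<gamma>\<^sup>2 = (1 + \<delta> + \<delta>\<^sup>2) * s\<^sup>2" unfolding mult_cancel_left by simp
  have "(1 + \<gamma>)\<^sup>2 = (1 + \<delta>)\<^sup>2 * s\<^sup>2" by (simp add: 1 power_mult_distrib)
  with 2 have "(1 + \<gamma>)\<^sup>2 * ((1 + \<delta> + \<delta>\<^sup>2) * s\<^sup>2) = (1 + \<delta>)\<^sup>2 * s\<^sup>2 * (1 + \<gamma> + \<gamma>\<^sup>2)" by simp
  then have "s\<^sup>2 * ((\<gamma> - \<delta>) * (\<gamma> * \<delta> - 1)) = 0" by algebra
  moreover have "s \<noteq> 0"
  proof
    assume "s = 0"
    then have "1 + \<gamma> = 0" "1 + \<gamma> + \<gamma>\<^sup>2 = 0" using 1 2 by auto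
    then show False by algebra
  qed
  ultimately show ?thesis by simp
qed

text \<open>Traces at the preimage \<open>u\<close> of \<open>x\<close> force \<open>\<gamma> = 1\<close> and fourth coordinate \<open>1\<close>. In \<open>L1 1\<close> the right
  multiplication \<open>R\<close> by such an element satisfies \<open>(R - 2) (R - 1) R = 0\<close>, whereas in \<open>L3\<close> the
  corresponding expression for \<open>x\<close>, applied to \<open>e 1\<close>, gives \<open>- e 2\<close>.\<close>

lemma L1_not_isomorphic_L3: "\<not> isomorphic4 (L1 \<gamma>) L3"
proof
  assume "isomorphic4 (L1 \<gamma>) L3"
  from isomorphic4E[OF this] obtain f where f: "bij f" "Vector_Spaces.linear (*s) (*s) f"
    "\<forall>u v. f (L1 \<gamma> u v) = L3 (f u) (f v)" .
  obtain u v where u: "f u = e 4" and v: "f v = e 1" using bij_is_surj[OF f(1)] by (metis surjD)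
  define s where "s = u $ 4"
  note tr = isomorphism_preserves_traces[OF leibniz_L1 leibniz_L3 f, of u]
  have "2 * ((1 + \<gamma>) * s) = 2 * 2"
    using tr(1) by (simp add: traces_L1 traces_L3 s_def u axis_def algebra_simps)
  then have 1: "(1 + \<gamma>) * s = 2" unfolding mult_cancel_left by simp
  have "2 * ((1 + \<gamma> + \<gamma>\<^sup>2) * s\<^sup>2) = 2 * 3"
    using tr(2) by (simp add: traces_L1 traces_L3 s_def u axis_def algebra_simps)
  then have 2: "(1 + \<gamma> + \<gamma>\<^sup>2) * s\<^sup>2 = 3" unfolding mult_cancel_left by simp
  have "((\<gamma> - 1) * s)\<^sup>2 = 4 * ((1 + \<gamma> + \<gamma>\<^sup>2) * s\<^sup>2) - 3 * ((1 + \<gamma>) * s)\<^sup>2"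
    by (simp add: power2_eq_square algebra_simps)
  also have "\<dots> = 0" unfolding 1 2 by simp
  finally have "((\<gamma> - 1) * s)\<^sup>2 = 0" .
  moreover have "s \<noteq> 0" using 1 by auto
  ultimately have \<gamma>: "\<gamma> = 1" by simp
  with 1 have s: "u $ 4 = 1" by (simp add: s_def)
  define R where "R w = L1 \<gamma> w u" for w
  define w1 where "w1 = R v"
  define w2 where "w2 = R w1 - w1"
  have "R w2 = 2 *s w2"
    by (simp add: w2_def w1_def R_def L1_def \<gamma> table_simps s algebra_simps)
  have fR: "f (R w) = L3 (f w) (e 4)" for w by (simp add: R_def f(3) u)
  have fw1: "f w1 = e 1 + e 2" by (simp add: w1_def fR v L3_def table_simps)
  have "f w2 = f (R w1) - f w1"
    unfolding w2_def by (rule module_hom.diff[OF f(2)[unfolded linear_iff_module_hom]])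
  also have "\<dots> = e 2" by (simp add: fR fw1 L3_def table_simps)
  finally have fw2: "f w2 = e 2" .
  have "f (2 *s w2) = 2 *s e 2"
    using module_hom.scale[OF f(2)[unfolded linear_iff_module_hom]] by (simp add: fw2)
  moreover have "f (R w2) = e 2" by (simp add: fR fw2 L3_def table_simps)
  ultimately show False using \<open>R w2 = 2 *s w2\<close> by (simp add: vec_eq_iff forall_4 axis_def)
qed

lemma isomorphic4_preserves_alternating:
  assumes "isomorphic4 B B'"
  shows "(\<forall>u. B u u = 0) \<longleftrightarrow> (\<forall>u. B' u u = 0)"
proof -
  obtain f where f: "bij f" "Vector_Spaces.linear (*s) (*s) f"
    "\<forall>u v. f (B u v) = B' (f u) (f v)"
    using isomorphic4E[OF assms] .
  have "f 0 = 0" by (rule module_hom.zero[OF f(2)[unfolded linear_iff_module_hom]])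
  then have "f w = 0 \<longleftrightarrow> w = 0" for w by (metis bij_is_inj f(1) injD)
  then show ?thesis using f(3) bij_is_surj[OF f(1)] by (metis surjD)
qed

lemma alternating_L1: "L1 \<gamma> u u = 0"
  by (simp add: L1_def table_simps algebra_simps)

lemma alternating_L3: "L3 u u = 0"
  by (simp add: L3_def table_simps algebra_simps)

lemma not_alternating_L2: "L2 (e 4) (e 4) \<noteq> 0"
  by (simp add: L2_def table_simps)

theorem proposition3p8:
  fixes scale :: "complex \<Rightarrow> 'a::ab_group_add \<Rightarrow> 'a"
    and br :: "'a \<Rightarrow> 'a \<Rightarrow> 'a"
  shows "(leibniz_algebra scale br \<and>
          vector_space.dim scale (UNIV :: 'a set) = 4 \<and>
          leibniz_algebra.solvable scale br UNIV \<and>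
          (\<exists>N. leibniz_algebra.is_nilradical scale br N \<and>
               algebra_isomorphic scale N br (*s) UNIV lambda3)
          \<longrightarrow>
          (\<exists>\<gamma>. algebra_isomorphic scale UNIV br (*s) UNIV (L1 \<gamma>)) \<or>
          algebra_isomorphic scale UNIV br (*s) UNIV L2 \<or>
          algebra_isomorphic scale UNIV br (*s) UNIV L3) \<and>
         (\<forall>\<gamma>. \<not> isomorphic4 (L1 \<gamma>) L2) \<and>
         (\<forall>\<gamma>. \<not> isomorphic4 (L1 \<gamma>) L3) \<and>
         \<not> isomorphic4 L2 L3 \<and>
         (\<forall>\<gamma> \<delta>. \<gamma> \<noteq> \<delta> \<and> \<gamma> * \<delta> \<noteq> 1 \<longrightarrow> \<not> isomorphic4 (L1 \<gamma>) (L1 \<delta>))"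
proof (intro conjI impI allI)
  assume A: "leibniz_algebra scale br \<and>
          vector_space.dim scale (UNIV :: 'a set) = 4 \<and>
          leibniz_algebra.solvable scale br UNIV \<and>
          (\<exists>N. leibniz_algebra.is_nilradical scale br N \<and>
               algebra_isomorphic scale N br (*s) UNIV lambda3)"
  then obtain N a b c x where H: "heisenberg_extension scale br N"
    "heisenberg_extension.heisenberg_basis scale br N a b c" "x \<notin> N"
    by (metis lambda3_nilradical_heisenberg_extension)
  show "(\<exists>\<gamma>. algebra_isomorphic scale UNIV br (*s) UNIV (L1 \<gamma>)) \<or>
          algebra_isomorphic scale UNIV br (*s) UNIV L2 \<or>
          algebra_isomorphic scale UNIV br (*s) UNIV L3"
    using heisenberg_extension.classification[OF H] .
next
  show "\<not> isomorphic4 (L1 \<gamma>) L2" for \<gamma>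
    using isomorphic4_preserves_alternating alternating_L1 not_alternating_L2 by blast
  show "\<not> isomorphic4 L2 L3"
    using isomorphic4_preserves_alternating alternating_L3 not_alternating_L2 by blast
qed (use L1_not_isomorphic_L3 L1_isomorphic_only_inverse in auto)

end
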